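(* Let the norm $\|\cdot\|$ used at every stage be the $l_\infty$ norm. Let $\delta_t\in[0,+\infty)$, $t=1,\dots,T$, be given and define $$\epsilon_t:=\begin{cases}0,& t=T-1,\\ \sum_{\tau=t}^{T-2}(M_{\tau+1}+\underline M_{\tau+1})\,\delta_{\tau+1}\,\lambda^{\tau-t},& 0\le t\le T-2.\end{cases}$$ Then the number of iterations performed by the EDDP method to find a solution $x_1^k$ satisfying $F_{11}(x_1^k)-F^*\le\epsilon_0$ is bounded by $\bar K+1$, where $$\bar K:=\sum_{t=1}^{T-1}\Big(\frac{D_t}{\delta_t}+1\Big)^{n_t}.$$ In particular, if $n_t\le n$, $D_t\le D$, $\max\{M_t,\underline M_t\}\le M$ and $\delta_t=\epsilon$ for all $t=1,\dots,T$ (with $\epsilon>0$), then the EDDP method finds $x_1^k$ with $$F_{11}(x_1^k)-F^*\le 2M\min\Big\{\frac1{1-\lambda},\,T-1\Big\}\,\epsilon$$ within at most $\bar K_\epsilon+1$ iterations, where $\bar K_\epsilon:=(T-1)\big(\frac D\epsilon+1\big)^n$. (Here $1/(1-\lambda)=+\infty$ if $\lambda=1$; $\bar K=+\infty$ if some $\delta_t=0$ with $1\le t\le T-1$.)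
   Context: **Problem (sample average approximation).** $T\ge2$ stages, $\lambda\in(0,1]$. For each stage $t$ there are $N_t$ given realizations $\tilde\xi_{ti}=(\tilde A_{ti},\tilde b_{ti},\tilde B_{ti},\tilde Q_{ti},\tilde p_{ti},\tilde c_{ti})$, $i=1,\dots,N_t$, with $N_1=1$ (first stage deterministic). $\bar X_t\subseteq\mathbb R^{n_t}$ is closed convex, $H_t(\cdot,c)$ is closed convex, the components of $\Phi_t(\cdot,p)$ are closed convex, and the $\tilde A,\tilde B,\tilde Q$ are linear maps. For $t\ge2$, $X_t(x_{t-1},\tilde\xi_{ti}):=\{x\in\bar X_t:\tilde A_{ti}x=\tilde B_{ti}x_{t-1}+\tilde b_{ti},\ \Phi_t(x,\tilde p_{ti})\le\tilde Q_{ti}x_{t-1}\}$; $X_1:=\{x\in\bar X_1:\tilde A_{11}x=\tilde b_{11},\Phi_1(x,\tilde p_{11})\le0\}$ and $X_1(x_0,\tilde\xi_{11})\equiv X_1$. Set $V_{T+1}\equiv0$, $F_{ti}(x):=H_t(x,\tilde c_{ti})+\lambda V_{t+1}(x)$, $\nu_{ti}(x_{t-1}):=\min_{x\in X_t(x_{t-1},\tilde\xi_{ti})}F_{ti}(x)$, $V_t(x_{t-1}):=\frac1{N_t}\sum_{i=1}^{N_t}\nu_{ti}(x_{t-1})$ for $t=T,\dots,2$. The problem is $F^*:=\min_{x_1\in X_1}F_{11}(x_1)$. **Effective regions.** $\mathcal X_{11}=\bar{\mathcal X}_1:=X_1$; for $t\ge2$, $\mathcal X_{ti}:=\bigcup_{x\in\bar{\mathcal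 X}_{t-1}}X_t(x,\tilde\xi_{ti})$, $\bar{\mathcal X}_t:=\bigcup_{i=1}^{N_t}\mathcal X_{ti}$; $\bar{\mathcal X}_t(\epsilon):=\bar{\mathcal X}_t+\{y\in\mathrm{Aff}(\bar{\mathcal X}_t):\|y\|\le\epsilon\}$, where $\mathrm{Aff}$ denotes the affine hull (in the second summand, its direction space). **Standing assumptions.** (1) $\|x-x'\|\le D_t$ for all $x,x'\in\bar{\mathcal X}_t$, with $D_t\ge0$. (2) For each $t$ there is $\bar\epsilon_t\in(0,\infty)$ such that for all $x\in\bar{\mathcal X}_t(\bar\epsilon_t)$: $H_t(x,\tilde c_{ti})<+\infty$ for $i=1,\dots,N_t$ and (for $t\le T-1$) the relative interior of $X_{t+1}(x,\tilde\xi_{(t+1)i})$ is nonempty for $i=1,\dots,N_{t+1}$. (3) $M_t\ge0$ satisfies $|F_{ti}(x)-F_{ti}(x')|\le M_t\|x-x'\|$ for all $x,x'\in\bar{\mathcal X}_t$ and all $i$. **EDDP method** (input $\delta_t$). Set $\underline V_t^0\equiv-\infty$ for $t=2,\dots,T$, $\underline V_{T+1}^k\equiv0$ for all $k\ge0$, $S_t^0=\emptyset$; write $\underline F_{ti}^k(x):=H_t(x,\tilde c_{ti})+\lambda\underline V_{t+1}^k(x)$. Iteration $k=1,2,\dots$: Forward phase, $t=1,\dots,T$: for $i=1,\dots,N_t$ compute $\tilde x_{ti}^k\in\operatorname{Argmin}\{\underline F_{ti}^{k-1}(x):x\in X_t(x_{t-1}^k,\tilde\xi_{ti})\}$ (any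 feasible point if the objective is $-\infty$), and set, for every $x$, $g_t^k(x)=\min_{s\in S_t^{k-1}}\|s-x\|$ if $t<T$ ($+\infty$ if $S_t^{k-1}=\emptyset$) and $g_T^k(x)=0$; choose $x_t^k\in\{\tilde x_{ti}^k\}_i$ with $g_t^k(x_t^k)=\max_ig_t^k(\tilde x_{ti}^k)$. If $g_1^k(x_1^k)\le\delta_1$, terminate. Backward phase, $t=T,\dots,2$: if $g_t^k(x_t^k)\le\delta_t$ set $S_{t-1}^k=S_{t-1}^{k-1}\cup\{x_{t-1}^k\}$, otherwise $S_{t-1}^k=S_{t-1}^{k-1}$; for $i=1,\dots,N_t$ let $\tilde\nu_{ti}^k(x):=\min\{\underline F_{ti}^k(y):y\in X_t(x,\tilde\xi_{ti})\}$, compute $\tilde\nu_{ti}^k(x_{t-1}^k)$ and its subgradient $(\tilde\nu_{ti}^k)'(x_{t-1}^k)=[\tilde B_{ti},\tilde Q_{ti}]y_{ti}^k$ at $x_{t-1}^k$ given by optimal dual multipliers $y_{ti}^k$ (read with appropriate adjoints/signs), and set $\underline V_t^k(x)=\max\{\underline V_t^{k-1}(x),\ \frac1{N_t}\sum_j\tilde\nu_{tj}^k(x_{t-1}^k)+\langle\frac1{N_t}\sum_j(\tilde\nu_{tj}^k)'(x_{t-1}^k),x-x_{t-1}^k\rangle\}$. Minimizers and multipliers are taken to exist (the paper regards this as ensured by assumption (2)). **Constants.** $\underline M_t\ge0$ satisfies $|\underline F_{ti}^k(x)-\underline F_{ti}^k(x')|\le\underline M_t\|x-x'\|$ for all $x,x'\in\bar{\mathcal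 X}_t(\bar\epsilon_t)$, all $i$ and all $k\ge1$. *)

theory Defs
  imports "HOL-Analysis.Analysis"
begin

text \<open>
  The stage dimensions depend on the stage and the number of stages is a variable, so the spaces
  of the individual stages are coordinate subspaces of one ambient space of arbitrary dimension:
  a set of coordinates \<open>I\<close> with \<open>card I = n\<close> stands for the n-dimensional space.  On such a subspace
  the ambient \<^const>\<open>infnorm\<close> is the maximum norm of the n coordinates.
\<close>

definition coord_space :: "'n::finite set \<Rightarrow> (real^'n) set" where
  "coord_space I = {x. \<forall>i. i \<notin> I \<longrightarrow> x $ i = 0}"

text \<open>Closed convex functions with values in \<open>(-\<infinity>, +\<infinity>]\<close>, by their epigraphs.\<close>

definition closed_convex_fun_on :: "(real^'n::finite) set \<Rightarrow> (real^'n \<Rightarrow> ereal) \<Rightarrow> bool" where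
  "closed_convex_fun_on S f \<longleftrightarrow>
     (\<forall>x\<in>S. f x \<noteq> -\<infinity>) \<and>
     closed {(x, r :: real). x \<in> S \<and> f x \<le> ereal r} \<and>
     convex {(x, r :: real). x \<in> S \<and> f x \<le> ereal r}"

text \<open>
  One realization \<open>(A, b, B, Q, p, c)\<close>.  The number of equations and of inequalities may depend on
  the stage: unused rows are padded with trivial constraints.
\<close>

record ('n::finite, 'm::finite, 'q::finite, 'p, 'c) realization =
  matA :: "real^'n^'m"
  vecb :: "real^'m"
  matB :: "real^'n^'m"
  matQ :: "real^'n^'q"
  parp :: 'p
  parc :: 'c

text \<open>
  Stages are \<open>t = 1, \<dots>, horizon P\<close>, and \<open>xi P t i\<close> for \<open>i = 1, \<dots>, scen P t\<close> are the realizations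
  at stage \<open>t\<close>.
\<close>

record ('n::finite, 'm::finite, 'q::finite, 'p, 'c) msp =
  horizon :: nat
  disc :: real
  coords :: "nat \<Rightarrow> 'n set"
  scen :: "nat \<Rightarrow> nat"
  xi :: "nat \<Rightarrow> nat \<Rightarrow> ('n, 'm, 'q, 'p, 'c) realization"
  Xbar :: "nat \<Rightarrow> (real^'n) set"
  H :: "nat \<Rightarrow> real^'n \<Rightarrow> 'c \<Rightarrow> ereal"
  Phi :: "nat \<Rightarrow> real^'n \<Rightarrow> 'p \<Rightarrow> 'q \<Rightarrow> ereal"

definition stage_dim :: "('n::finite, 'm::finite, 'q::finite, 'p, 'c) msp \<Rightarrow> nat \<Rightarrow> nat" where
  "stage_dim P t = card (coords P t)"

definition msp_problem :: "('n::finite, 'm::finite, 'q::finite, 'p, 'c) msp \<Rightarrow> bool" where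
  "msp_problem P \<longleftrightarrow>
     2 \<le> horizon P \<and> 0 < disc P \<and> disc P \<le> 1 \<and> scen P 1 = 1 \<and>
     (\<forall>t\<in>{1..horizon P}.
        1 \<le> scen P t \<and>
        Xbar P t \<subseteq> coord_space (coords P t) \<and> closed (Xbar P t) \<and> convex (Xbar P t) \<and>
        (\<forall>i\<in>{1..scen P t}.
           closed_convex_fun_on (coord_space (coords P t)) (\<lambda>x. H P t x (parc (xi P t i))) \<and>
           (\<forall>j. closed_convex_fun_on (coord_space (coords P t))
                  (\<lambda>x. Phi P t x (parp (xi P t i)) j))))"

text \<open>The first-stage feasible set does not depend on the argument \<open>x\<close>.\<close>

definition feas :: "('n::finite, 'm::finite, 'q::finite, 'p, 'c) msp \<Rightarrow> nat \<Rightarrow> nat \<Rightarrow> real^'n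
    \<Rightarrow> (real^'n) set" where
  "feas P t i x =
     (let \<xi> = xi P t i in
      if t = 1
      then {z \<in> Xbar P 1. matA \<xi> *v z = vecb \<xi> \<and> (\<forall>j. Phi P 1 z (parp \<xi>) j \<le> 0)}
      else {z \<in> Xbar P t. matA \<xi> *v z = matB \<xi> *v x + vecb \<xi> \<and>
              (\<forall>j. Phi P t z (parp \<xi>) j \<le> ereal ((matQ \<xi> *v x) $ j))})"

text \<open>
  Values are extended reals and minima are infima (\<open>+\<infinity>\<close> over the empty set).  \<open>V P t\<close> is meant
  for \<open>t = 2, \<dots>, horizon P + 1\<close>.
\<close>

function V :: "('n::finite, 'm::finite, 'q::finite, 'p, 'c) msp \<Rightarrow> nat \<Rightarrow> real^'n \<Rightarrow> ereal" where
  "V P t x =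
     (if horizon P < t then 0
      else ereal (1 / real (scen P t)) *
        (\<Sum>i = 1..scen P t. INF z\<in>feas P t i x.
            H P t z (parc (xi P t i)) + ereal (disc P) * V P (Suc t) z))"
  by auto
termination
  by (relation "Wellfounded.measure (\<lambda>(P, t, x). Suc (horizon P) - t)") auto

declare V.simps [simp del]

definition F :: "('n::finite, 'm::finite, 'q::finite, 'p, 'c) msp \<Rightarrow> nat \<Rightarrow> nat \<Rightarrow> real^'n \<Rightarrow> ereal" where
  "F P t i z = H P t z (parc (xi P t i)) + ereal (disc P) * V P (Suc t) z"

definition \<nu> :: "('n::finite, 'm::finite, 'q::finite, 'p, 'c) msp \<Rightarrow> nat \<Rightarrow> nat \<Rightarrow> real^'n \<Rightarrow> ereal" where
  "\<nu> P t i x = (INF z\<in>feas P t i x. F P t i z)"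

lemma V_eq_mean_\<nu>:
  assumes "t \<le> horizon P"
  shows "V P t x = ereal (1 / real (scen P t)) * (\<Sum>i = 1..scen P t. \<nu> P t i x)"
  using assms by (subst V.simps) (simp add: \<nu>_def F_def)

definition Fstar :: "('n::finite, 'm::finite, 'q::finite, 'p, 'c) msp \<Rightarrow> ereal" where
  "Fstar P = (INF z\<in>feas P 1 1 0. F P 1 1 z)"

primrec eff_region :: "('n::finite, 'm::finite, 'q::finite, 'p, 'c) msp \<Rightarrow> nat \<Rightarrow> (real^'n) set" where
  "eff_region P 0 = {}"
| "eff_region P (Suc t) =
     (if t = 0 then feas P 1 1 0
      else (\<Union>i\<in>{1..scen P (Suc t)}. \<Union>x\<in>eff_region P t. feas P (Suc t) i x))"

definition aff_dir :: "(real^'n::finite) set \<Rightarrow> (real^'n) set" where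
  "aff_dir S = {u - v | u v. u \<in> affine hull S \<and> v \<in> affine hull S}"

definition eff_region_enl :: "('n::finite, 'm::finite, 'q::finite, 'p, 'c) msp \<Rightarrow> nat \<Rightarrow> real
    \<Rightarrow> (real^'n) set" where
  "eff_region_enl P t e =
     {x + y | x y. x \<in> eff_region P t \<and> y \<in> aff_dir (eff_region P t) \<and> infnorm y \<le> e}"

definition diameter_bound :: "('n::finite, 'm::finite, 'q::finite, 'p, 'c) msp \<Rightarrow> (nat \<Rightarrow> real) \<Rightarrow> bool" where
  "diameter_bound P D \<longleftrightarrow>
     (\<forall>t\<in>{1..horizon P}. 0 \<le> D t \<and>
        (\<forall>x\<in>eff_region P t. \<forall>x'\<in>eff_region P t. infnorm (x - x') \<le> D t))"

definition regularity :: "('n::finite, 'm::finite, 'q::finite, 'p, 'c) msp \<Rightarrow> (nat \<Rightarrow> real) \<Rightarrow> bool" where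
  "regularity P ebar \<longleftrightarrow>
     (\<forall>t\<in>{1..horizon P}. 0 < ebar t \<and>
        (\<forall>x\<in>eff_region_enl P t (ebar t).
           (\<forall>i\<in>{1..scen P t}. H P t x (parc (xi P t i)) < \<infinity>) \<and>
           (t \<le> horizon P - 1 \<longrightarrow>
              (\<forall>i\<in>{1..scen P (Suc t)}. rel_interior (feas P (Suc t) i x) \<noteq> {}))))"

text \<open>
  Since \<open>\<infinity> - \<infinity> = \<infinity>\<close> in \<^typ>\<open>ereal\<close> (for either sign of infinity), such a bound, taken at
  \<open>x = x'\<close>, includes that the function is finite on the set.
\<close>

definition ereal_lipschitz_on :: "real \<Rightarrow> (real^'n::finite) set \<Rightarrow> (real^'n \<Rightarrow> ereal) \<Rightarrow> bool" where
  "ereal_lipschitz_on L S f \<longleftrightarrow>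
     (\<forall>x\<in>S. \<forall>x'\<in>S. \<bar>f x - f x'\<bar> \<le> ereal (L * infnorm (x - x')))"

definition objective_lipschitz :: "('n::finite, 'm::finite, 'q::finite, 'p, 'c) msp
    \<Rightarrow> (nat \<Rightarrow> real) \<Rightarrow> bool" where
  "objective_lipschitz P M \<longleftrightarrow>
     (\<forall>t\<in>{1..horizon P}. 0 \<le> M t \<and>
        (\<forall>i\<in>{1..scen P t}. ereal_lipschitz_on (M t) (eff_region P t) (F P t i)))"

text \<open>
  The method is nondeterministic (choice of minimizers, of dual multipliers and of the maximizing
  index).  An execution is the record of all the choices and iterates; the first argument of every
  field is the iteration \<open>k\<close>, the second the stage \<open>t\<close>, the third the realization \<open>i\<close>.
\<close>

record ('n::finite, 'm::finite, 'q::finite) eddp_exec =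
  xtrial :: "nat \<Rightarrow> nat \<Rightarrow> nat \<Rightarrow> real^'n"
  xsel :: "nat \<Rightarrow> nat \<Rightarrow> real^'n"
  Ssat :: "nat \<Rightarrow> nat \<Rightarrow> (real^'n) set"
  Vlow :: "nat \<Rightarrow> nat \<Rightarrow> real^'n \<Rightarrow> ereal"
  multE :: "nat \<Rightarrow> nat \<Rightarrow> nat \<Rightarrow> real^'m"
  multI :: "nat \<Rightarrow> nat \<Rightarrow> nat \<Rightarrow> real^'q"

definition Flow :: "('n::finite, 'm::finite, 'q::finite, 'p, 'c) msp \<Rightarrow> ('n, 'm, 'q) eddp_exec
    \<Rightarrow> nat \<Rightarrow> nat \<Rightarrow> nat \<Rightarrow> real^'n \<Rightarrow> ereal" where
  "Flow P R k t i z = H P t z (parc (xi P t i)) + ereal (disc P) * Vlow R k (Suc t) z"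

definition \<nu>low :: "('n::finite, 'm::finite, 'q::finite, 'p, 'c) msp \<Rightarrow> ('n, 'm, 'q) eddp_exec
    \<Rightarrow> nat \<Rightarrow> nat \<Rightarrow> nat \<Rightarrow> real^'n \<Rightarrow> ereal" where
  "\<nu>low P R k t i x = (INF z\<in>feas P t i x. Flow P R k t i z)"

definition sat_dist :: "('n::finite, 'm::finite, 'q::finite, 'p, 'c) msp \<Rightarrow> ('n, 'm, 'q) eddp_exec
    \<Rightarrow> nat \<Rightarrow> nat \<Rightarrow> real^'n \<Rightarrow> ereal" where
  "sat_dist P R k t x =
     (if t < horizon P then INF s\<in>Ssat R (k - 1) t. ereal (infnorm (s - x)) else 0)"

text \<open>
  Lagrangian dual of \<open>min {f z | z \<in> feas P t i x}\<close> for \<open>t \<ge> 2\<close>, with multipliers \<open>u\<close> of the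
  equations \<open>B x + b - A z = 0\<close> and \<open>v \<ge> 0\<close> of the inequalities \<open>\<Phi>(z) - Q x \<le> 0\<close>.  As usual the
  Lagrangian is \<open>+\<infinity>\<close> outside the domain of \<open>\<Phi>\<close>.  With these signs the subgradient of the
  value function belonging to \<open>(u, v)\<close> is the gradient of the Lagrangian in \<open>x\<close>.
\<close>

definition dual_fun :: "('n::finite, 'm::finite, 'q::finite, 'p, 'c) msp \<Rightarrow> nat \<Rightarrow> nat
    \<Rightarrow> (real^'n \<Rightarrow> ereal) \<Rightarrow> real^'n \<Rightarrow> real^'m \<Rightarrow> real^'q \<Rightarrow> ereal" where
  "dual_fun P t i f x u v =
     (let \<xi> = xi P t i in
      INF z\<in>{z \<in> Xbar P t. \<forall>j. Phi P t z (parp \<xi>) j < \<infinity>}.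
        f z + ereal (u \<bullet> (matB \<xi> *v x + vecb \<xi> - matA \<xi> *v z)
                     + (\<Sum>j\<in>UNIV. v $ j * (real_of_ereal (Phi P t z (parp \<xi>) j) - (matQ \<xi> *v x) $ j))))"

text \<open>
  Dual optimality includes the absence of a duality gap, without which dual solutions are
  not subgradients of the value function.
\<close>

definition optimal_multipliers :: "('n::finite, 'm::finite, 'q::finite, 'p, 'c) msp \<Rightarrow> nat \<Rightarrow> nat
    \<Rightarrow> (real^'n \<Rightarrow> ereal) \<Rightarrow> real^'n \<Rightarrow> real^'m \<Rightarrow> real^'q \<Rightarrow> bool" where
  "optimal_multipliers P t i f x u v \<longleftrightarrow>
     (\<forall>j. 0 \<le> v $ j) \<and>
     (\<forall>u' v'. (\<forall>j. 0 \<le> v' $ j) \<longrightarrow> dual_fun P t i f x u' v' \<le> dual_fun P t i f x u v) \<and>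
     dual_fun P t i f x u v = (INF z\<in>feas P t i x. f z)"

definition subgrad :: "('n::finite, 'm::finite, 'q::finite, 'p, 'c) msp \<Rightarrow> ('n, 'm, 'q) eddp_exec
    \<Rightarrow> nat \<Rightarrow> nat \<Rightarrow> nat \<Rightarrow> real^'n" where
  "subgrad P R k t i =
     transpose (matB (xi P t i)) *v multE R k t i - transpose (matQ (xi P t i)) *v multI R k t i"

definition cut :: "('n::finite, 'm::finite, 'q::finite, 'p, 'c) msp \<Rightarrow> ('n, 'm, 'q) eddp_exec
    \<Rightarrow> nat \<Rightarrow> nat \<Rightarrow> real^'n \<Rightarrow> ereal" where
  "cut P R k t x =
     ereal (1 / real (scen P t)) * (\<Sum>j = 1..scen P t. \<nu>low P R k t j (xsel R k (t - 1)))
     + ereal (((1 / real (scen P t)) *\<^sub>R (\<Sum>j = 1..scen P t. subgrad P R k t j))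
                \<bullet> (x - xsel R k (t - 1)))"

definition stops :: "('n::finite, 'm::finite, 'q::finite, 'p, 'c) msp \<Rightarrow> (nat \<Rightarrow> real)
    \<Rightarrow> ('n, 'm, 'q) eddp_exec \<Rightarrow> nat \<Rightarrow> bool" where
  "stops P \<delta> R k \<longleftrightarrow> sat_dist P R k 1 (xsel R k 1) \<le> ereal (\<delta> 1)"

definition performed :: "('n::finite, 'm::finite, 'q::finite, 'p, 'c) msp \<Rightarrow> (nat \<Rightarrow> real)
    \<Rightarrow> ('n, 'm, 'q) eddp_exec \<Rightarrow> nat \<Rightarrow> bool" where
  "performed P \<delta> R k \<longleftrightarrow> 1 \<le> k \<and> (\<forall>j\<in>{1..<k}. \<not> stops P \<delta> R j)"

definition terminates_at :: "('n::finite, 'm::finite, 'q::finite, 'p, 'c) msp \<Rightarrow> (nat \<Rightarrow> real)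
    \<Rightarrow> ('n, 'm, 'q) eddp_exec \<Rightarrow> nat \<Rightarrow> bool" where
  "terminates_at P \<delta> R k \<longleftrightarrow> performed P \<delta> R k \<and> stops P \<delta> R k"

text \<open>Initially the lower model is \<open>-\<infinity>\<close>; then every feasible point is a minimizer.\<close>

definition forward_phase :: "('n::finite, 'm::finite, 'q::finite, 'p, 'c) msp
    \<Rightarrow> ('n, 'm, 'q) eddp_exec \<Rightarrow> nat \<Rightarrow> bool" where
  "forward_phase P R k \<longleftrightarrow>
     (\<forall>t\<in>{1..horizon P}.
        (\<forall>i\<in>{1..scen P t}.
           is_arg_min (Flow P R (k - 1) t i) (\<lambda>z. z \<in> feas P t i (xsel R k (t - 1)))
             (xtrial R k t i)) \<and>
        xsel R k t \<in> xtrial R k t ` {1..scen P t} \<and>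
        sat_dist P R k t (xsel R k t) = (MAX i\<in>{1..scen P t}. sat_dist P R k t (xtrial R k t i)))"

definition backward_phase :: "('n::finite, 'm::finite, 'q::finite, 'p, 'c) msp \<Rightarrow> (nat \<Rightarrow> real)
    \<Rightarrow> ('n, 'm, 'q) eddp_exec \<Rightarrow> nat \<Rightarrow> bool" where
  "backward_phase P \<delta> R k \<longleftrightarrow>
     (\<forall>t\<in>{2..horizon P}.
        Ssat R k (t - 1) =
          (if sat_dist P R k t (xsel R k t) \<le> ereal (\<delta> t)
           then insert (xsel R k (t - 1)) (Ssat R (k - 1) (t - 1))
           else Ssat R (k - 1) (t - 1)) \<and>
        (\<forall>i\<in>{1..scen P t}.
           optimal_multipliers P t i (Flow P R k t i) (xsel R k (t - 1))
             (multE R k t i) (multI R k t i)) \<and>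
        (\<forall>x. Vlow R k t x = max (Vlow R (k - 1) t x) (cut P R k t x)))"

definition eddp_run :: "('n::finite, 'm::finite, 'q::finite, 'p, 'c) msp \<Rightarrow> (nat \<Rightarrow> real)
    \<Rightarrow> ('n, 'm, 'q) eddp_exec \<Rightarrow> bool" where
  "eddp_run P \<delta> R \<longleftrightarrow>
     (\<forall>t\<in>{2..horizon P}. \<forall>x. Vlow R 0 t x = -\<infinity>) \<and>
     (\<forall>k x. Vlow R k (Suc (horizon P)) x = 0) \<and>
     (\<forall>t\<in>{1..<horizon P}. Ssat R 0 t = {}) \<and>
     (\<forall>k. performed P \<delta> R k \<longrightarrow>
        forward_phase P R k \<and> (\<not> stops P \<delta> R k \<longrightarrow> backward_phase P \<delta> R k))"

text \<open>The value is \<open>\<infinity>\<close> if the method never terminates.\<close>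

definition num_iterations :: "('n::finite, 'm::finite, 'q::finite, 'p, 'c) msp \<Rightarrow> (nat \<Rightarrow> real)
    \<Rightarrow> ('n, 'm, 'q) eddp_exec \<Rightarrow> enat" where
  "num_iterations P \<delta> R = (INF k\<in>{k. terminates_at P \<delta> R k}. enat k)"

text \<open>The lower models of iteration \<open>k\<close> exist only if its backward phase is carried out.\<close>

definition lower_lipschitz :: "('n::finite, 'm::finite, 'q::finite, 'p, 'c) msp \<Rightarrow> (nat \<Rightarrow> real)
    \<Rightarrow> ('n, 'm, 'q) eddp_exec \<Rightarrow> (nat \<Rightarrow> real) \<Rightarrow> (nat \<Rightarrow> real) \<Rightarrow> bool" where
  "lower_lipschitz P \<delta> R ebar Mlow \<longleftrightarrow>
     (\<forall>t\<in>{1..horizon P}. 0 \<le> Mlow t \<and>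
        (\<forall>k. performed P \<delta> R k \<and> \<not> stops P \<delta> R k \<longrightarrow>
           (\<forall>i\<in>{1..scen P t}.
              ereal_lipschitz_on (Mlow t) (eff_region_enl P t (ebar t)) (Flow P R k t i))))"

definition eps :: "('n::finite, 'm::finite, 'q::finite, 'p, 'c) msp \<Rightarrow> (nat \<Rightarrow> real)
    \<Rightarrow> (nat \<Rightarrow> real) \<Rightarrow> (nat \<Rightarrow> real) \<Rightarrow> nat \<Rightarrow> real" where
  "eps P M Mlow \<delta> t =
     (if t = horizon P - 1 then 0
      else \<Sum>\<tau> = t..horizon P - 2. (M (\<tau> + 1) + Mlow (\<tau> + 1)) * \<delta> (\<tau> + 1) * disc P ^ (\<tau> - t))"

definition Kbar :: "('n::finite, 'm::finite, 'q::finite, 'p, 'c) msp \<Rightarrow> (nat \<Rightarrow> real)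
    \<Rightarrow> (nat \<Rightarrow> real) \<Rightarrow> ereal" where
  "Kbar P D \<delta> =
     (if \<exists>t\<in>{1..horizon P - 1}. \<delta> t = 0 then \<infinity>
      else ereal (\<Sum>t = 1..horizon P - 1. (D t / \<delta> t + 1) ^ stage_dim P t))"

end

theory Submission
  imports Defs
begin

text \<open>
  Two arguments are combined.

  Accuracy (\<open>saturated_points\<close>, \<open>gap_at_termination\<close>).  Every cut is a lower bound of the true
  cost-to-go function, by weak duality (\<open>Vlow_le_V\<close>), and the cut computed at a point is tight there
  with respect to the current lower models.  Backward induction over the stages gives the meaning of
  saturation: at a saturated point of stage \<open>t\<close> the lower model of \<open>V (t + 1)\<close> is off by at most
  \<open>eps t\<close>.  Indeed, if all trial points of stage \<open>t\<close> are within \<open>\<delta> t\<close> of saturated points, then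
  moving from a trial point to a saturated one costs \<open>(M t + Mlow t) * \<delta> t\<close> by Lipschitz
  continuity, and at the saturated one the model error \<open>eps t\<close> enters discounted.  The sum is
  \<open>eps (t - 1)\<close> (\<open>eps_rec\<close>, \<open>trial_point_gap\<close>), and it bounds the model error at the point of
  stage \<open>t - 1\<close> from which the trial points were computed.  The stopping rule is this situation at
  stage 1, where the model error bounds the optimality gap, by \<open>eps 0\<close>.

  Counting (\<open>performed_le\<close>).  An iteration that does not stop has a last stage \<open>t\<close> whose selected
  point is farther than \<open>\<delta> t\<close> from all saturated points; this point is then added to them
  (\<open>ex_new_saturated\<close>).  The points that enter in this way are pairwise more than \<open>\<delta> t\<close> apart in a
  set of diameter \<open>D t\<close>, so in the maximum norm there are at most \<open>(D t / \<delta> t + 1) ^ n\<close> of them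
  in dimension \<open>n\<close> (\<open>card_infnorm_separated_le\<close>), and the sum over the stages bounds the number of
  iterations before the last one.

  Infinite values need care, as the functions may be infinite outside the effective regions.
  Error bounds are therefore stated as \<open>a \<le> b + ereal c\<close> rather than for the difference \<open>a - b\<close>,
  so that monotonicity of addition suffices to combine them.
\<close>

section \<open>Packing in the maximum norm\<close>

lemma infnorm_le_componentwise:
  fixes x :: "real^'n::finite"
  assumes "\<And>i. \<bar>x $ i\<bar> \<le> r"
  shows "infnorm x \<le> r"
  unfolding infnorm_cart by (rule cSup_least) (use assms in auto)

text \<open>
  A set of diameter \<open>D\<close> in the maximum norm lies in a cube of side \<open>D\<close>.  Cut the cube into cells of
  side \<open>\<delta>\<close>: there are at most \<open>D / \<delta> + 1\<close> of them per coordinate, and two points of one cell are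
  at distance at most \<open>\<delta>\<close>.
\<close>

lemma card_infnorm_separated_le:
  fixes X :: "(real^'n::finite) set"
  assumes sub: "X \<subseteq> coord_space I" and "0 < \<delta>" "0 \<le> D"
    and diam: "\<And>x y. x \<in> X \<Longrightarrow> y \<in> X \<Longrightarrow> infnorm (x - y) \<le> D"
    and sep: "\<And>x y. x \<in> X \<Longrightarrow> y \<in> X \<Longrightarrow> x \<noteq> y \<Longrightarrow> \<delta> < infnorm (x - y)"
  shows "finite X" and "real (card X) \<le> (D / \<delta> + 1) ^ card I"
proof -
  define a where "a i = (INF x\<in>X. x $ i)" for i
  define m where "m = nat \<lfloor>D / \<delta>\<rfloor>"
  define cell where "cell x = restrict (\<lambda>i. nat \<lfloor>(x $ i - a i) / \<delta>\<rfloor>) I" for x :: "real^'n"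
  have coord: "\<bar>x $ i - y $ i\<bar> \<le> D" if "x \<in> X" "y \<in> X" for x y i
    using component_le_infnorm_cart[of "x - y" i] diam[OF that] by simp
  have bdd: "bdd_below ((\<lambda>x. x $ i) ` X)" for i
  proof (cases "X = {}")
    case False
    then obtain z where "z \<in> X" by blast
    show ?thesis
      by (rule bdd_belowI2[of _ "z $ i - D"]) (use coord[OF \<open>z \<in> X\<close>] in \<open>smt (verit)\<close>)
  qed simp
  have low: "a i \<le> x $ i" if "x \<in> X" for x i
    unfolding a_def by (rule cINF_lower[OF bdd that])
  have up: "x $ i - a i \<le> D" if "x \<in> X" for x i
  proof -
    have "x $ i - D \<le> a i"
      unfolding a_def by (rule cINF_greatest) (use that coord[OF that] in \<open>auto simp: abs_le_iff algebra_simps\<close>)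
    then show ?thesis by simp
  qed
  have range: "cell ` X \<subseteq> I \<rightarrow>\<^sub>E {..m}"
    using \<open>0 < \<delta>\<close> up by (auto simp: cell_def m_def intro!: nat_mono floor_mono divide_right_mono)
  have inj: "inj_on cell X"
  proof (rule inj_onI, rule ccontr)
    fix x y assume xy: "x \<in> X" "y \<in> X" "cell x = cell y" "x \<noteq> y"
    have "\<bar>(x - y) $ i\<bar> \<le> \<delta>" for i
    proof (cases "i \<in> I")
      case True
      let ?p = "(x $ i - a i) / \<delta>" and ?q = "(y $ i - a i) / \<delta>"
      have "nat \<lfloor>?p\<rfloor> = nat \<lfloor>?q\<rfloor>"
        using fun_cong[OF xy(3), of i] True by (simp add: cell_def)
      moreover have "0 \<le> ?p" "0 \<le> ?q"
        using low xy(1,2) \<open>0 < \<delta>\<close> by auto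
      ultimately have "\<lfloor>?p\<rfloor> = \<lfloor>?q\<rfloor>"
        by (simp add: eq_nat_nat_iff)
      then have "\<bar>?p - ?q\<bar> \<le> 1"
        by linarith
      then have "\<bar>(x $ i - y $ i) / \<delta>\<bar> \<le> 1"
        by (simp add: diff_divide_distrib)
      then show ?thesis
        using \<open>0 < \<delta>\<close> by (simp add: field_simps)
    next
      case False
      then have "x $ i = 0" "y $ i = 0"
        using sub xy(1,2) by (auto simp: coord_space_def)
      then show ?thesis
        using \<open>0 < \<delta>\<close> by simp
    qed
    then have "infnorm (x - y) \<le> \<delta>"
      by (rule infnorm_le_componentwise)
    with sep[OF xy(1,2,4)] show False by simp
  qed
  have fin: "finite (I \<rightarrow>\<^sub>E {..m})"
    by (intro finite_PiE) auto
  show "finite X"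
    using inj range fin by (metis finite_imageD finite_subset)
  have "card X \<le> card (I \<rightarrow>\<^sub>E {..m})"
    using card_inj_on_le[OF inj range fin] .
  also have "\<dots> = (m + 1) ^ card I"
    by (simp add: card_PiE)
  finally have "real (card X) \<le> real ((m + 1) ^ card I)"
    by (rule of_nat_mono)
  also have "\<dots> \<le> (D / \<delta> + 1) ^ card I"
    using \<open>0 < \<delta>\<close> \<open>0 \<le> D\<close> by (auto simp: m_def intro!: power_mono)
  finally show "real (card X) \<le> (D / \<delta> + 1) ^ card I" .
qed

section \<open>Extended reals\<close>

lemma ereal_abs_diff_leD:
  fixes a b :: ereal
  assumes "\<bar>a - b\<bar> \<le> ereal c"
  shows "a \<le> b + ereal c"
  using assms by (cases a; cases b) auto

lemma ereal_scale_sum_add: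
  fixes f :: "'i \<Rightarrow> ereal" and c :: "'i \<Rightarrow> real"
  assumes "0 \<le> r"
  shows "ereal r * (\<Sum>i\<in>A. f i + ereal (c i)) = ereal r * (\<Sum>i\<in>A. f i) + ereal (r * (\<Sum>i\<in>A. c i))"
  using assms by (simp add: sum.distrib ereal_pos_distrib)

lemma INF_finite_attained:
  fixes f :: "'b \<Rightarrow> 'a::complete_linorder"
  assumes "finite A" "A \<noteq> {}"
  obtains a where "a \<in> A" "(INF x\<in>A. f x) = f a"
proof -
  have "Min (f ` A) \<in> f ` A"
    using assms by (intro Min_in) auto
  moreover have "Min (f ` A) = (INF x\<in>A. f x)"
    using assms by (simp add: Min_Inf)
  ultimately show thesis using that by auto
qed

section \<open>Lagrangian duality\<close>

text \<open>
  For fixed multipliers the Lagrangian is affine in the parameter \<open>x\<close>, with the same gradient for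
  every \<open>z\<close>, hence so is its infimum over \<open>z\<close>.
\<close>

lemma dual_fun_affine_le:
  fixes P :: "('n::finite, 'm::finite, 'q::finite, 'p, 'c) msp"
  shows "dual_fun P t i f x u v
      + ereal ((transpose (matB (xi P t i)) *v u - transpose (matQ (xi P t i)) *v v) \<bullet> (y - x))
    \<le> dual_fun P t i f y u v"
proof -
  define X where "X = {z \<in> Xbar P t. \<forall>j. Phi P t z (parp (xi P t i)) j < \<infinity>}"
  define L where "L w z = u \<bullet> (matB (xi P t i) *v w + vecb (xi P t i) - matA (xi P t i) *v z)
     + (\<Sum>j\<in>UNIV. v $ j * (real_of_ereal (Phi P t z (parp (xi P t i)) j) - (matQ (xi P t i) *v w) $ j))"
    for w z
  let ?g = "transpose (matB (xi P t i)) *v u - transpose (matQ (xi P t i)) *v v"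
  have dual: "dual_fun P t i f w u v = (INF z\<in>X. f z + ereal (L w z))" for w
    by (simp add: dual_fun_def X_def L_def Let_def)
  have L: "L w z = u \<bullet> (matB (xi P t i) *v w) - v \<bullet> (matQ (xi P t i) *v w) + L 0 z" for w z
    unfolding L_def by (simp add: inner_vec_def algebra_simps sum.distrib sum_subtractf sum_negf)
  have g: "?g \<bullet> w = u \<bullet> (matB (xi P t i) *v w) - v \<bullet> (matQ (xi P t i) *v w)" for w
    by (simp add: inner_diff_left dot_lmul_matrix)
  have shift: "L y z = L x z + ?g \<bullet> (y - x)" for z
    unfolding L[of x] L[of y] inner_diff_right g by simp
  show ?thesis
    unfolding dual
  proof (rule INF_greatest)
    fix z assume "z \<in> X"
    then have "(INF z\<in>X. f z + ereal (L x z)) \<le> f z + ereal (L x z)"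
      by (rule INF_lower)
    then have "(INF z\<in>X. f z + ereal (L x z)) + ereal (?g \<bullet> (y - x))
        \<le> f z + ereal (L x z) + ereal (?g \<bullet> (y - x))"
      by (rule add_right_mono)
    also have "\<dots> = f z + ereal (L y z)"
      by (simp add: shift add.assoc)
    finally show "(INF z\<in>X. f z + ereal (L x z)) + ereal (?g \<bullet> (y - x)) \<le> f z + ereal (L y z)" .
  qed
qed

text \<open>
  Weak duality.  The slack of each inequality is a difference of reals, because a closed convex
  function does not take the value \<open>-\<infinity>\<close>; multiplied by \<open>v \<ge> 0\<close> it can only lower the objective.
\<close>

lemma dual_fun_le_INF_feas:
  fixes P :: "('n::finite, 'm::finite, 'q::finite, 'p, 'c) msp"
  assumes prob: "msp_problem P" and t: "t \<in> {2..horizon P}" and i: "i \<in> {1..scen P t}"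
    and v: "\<forall>j. 0 \<le> v $ j"
  shows "dual_fun P t i f x u v \<le> (INF z\<in>feas P t i x. f z)"
proof (rule INF_greatest)
  fix z assume z: "z \<in> feas P t i x"
  let ?\<Phi> = "Phi P t z (parp (xi P t i))" and ?Q = "matQ (xi P t i) *v x"
  have zX: "z \<in> Xbar P t" and eq: "matA (xi P t i) *v z = matB (xi P t i) *v x + vecb (xi P t i)"
    and ineq: "\<And>j. ?\<Phi> j \<le> ereal (?Q $ j)"
    using z t by (auto simp: feas_def Let_def)
  have "z \<in> coord_space (coords P t)"
    using prob t zX by (auto simp: msp_problem_def)
  then have fin: "?\<Phi> j \<noteq> -\<infinity>" for j
    using prob t i by (fastforce simp: msp_problem_def closed_convex_fun_on_def)
  have slack: "real_of_ereal (?\<Phi> j) \<le> ?Q $ j" for j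
    using ineq[of j] fin[of j] by (cases "?\<Phi> j") auto
  have "(\<Sum>j\<in>UNIV. v $ j * (real_of_ereal (?\<Phi> j) - ?Q $ j)) \<le> 0"
    using v slack by (intro sum_nonpos) (simp add: mult_nonneg_nonpos)
  then have "f z + ereal (u \<bullet> (matB (xi P t i) *v x + vecb (xi P t i) - matA (xi P t i) *v z)
        + (\<Sum>j\<in>UNIV. v $ j * (real_of_ereal (?\<Phi> j) - ?Q $ j))) \<le> f z + 0"
    by (intro add_left_mono) (simp add: eq)
  moreover have "?\<Phi> j < \<infinity>" for j
    using ineq[of j] by (cases "?\<Phi> j") auto
  ultimately show "dual_fun P t i f x u v \<le> f z"
    unfolding dual_fun_def Let_def by (intro INF_lower2[of z]) (use zX in auto)
qed


section \<open>The recursion of the tolerances\<close>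

lemma eps_rec:
  assumes "Suc t < horizon P"
  shows "eps P M Mlow \<delta> t
    = (M (Suc t) + Mlow (Suc t)) * \<delta> (Suc t) + disc P * eps P M Mlow \<delta> (Suc t)"
proof (cases "Suc t = horizon P - 1")
  case True
  then have "horizon P - 2 = t" by simp
  with True show ?thesis by (simp add: eps_def)
next
  case False
  let ?c = "\<lambda>\<tau>. (M (\<tau> + 1) + Mlow (\<tau> + 1)) * \<delta> (\<tau> + 1)"
  have le: "t \<le> horizon P - 2" "Suc t \<le> horizon P - 2" and ne: "t \<noteq> horizon P - 1"
    using assms False by auto
  have "eps P M Mlow \<delta> t = ?c t + (\<Sum>\<tau> = Suc t..horizon P - 2. ?c \<tau> * disc P ^ (\<tau> - t))"
    using ne le by (simp add: eps_def sum.atLeast_Suc_atMost)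
  also have "(\<Sum>\<tau> = Suc t..horizon P - 2. ?c \<tau> * disc P ^ (\<tau> - t))
      = (\<Sum>\<tau> = Suc t..horizon P - 2. disc P * (?c \<tau> * disc P ^ (\<tau> - Suc t)))"
    by (rule sum.cong) (auto simp: Suc_diff_Suc[symmetric])
  also have "\<dots> = disc P * eps P M Mlow \<delta> (Suc t)"
    using False by (simp add: eps_def sum_distrib_left)
  finally show ?thesis by simp
qed

section \<open>Invariants of an execution\<close>

locale eddp_execution =
  fixes P :: "('n::finite, 'm::finite, 'q::finite, 'p, 'c) msp"
    and R :: "('n, 'm, 'q) eddp_exec"
    and D M Mlow ebar \<delta> :: "nat \<Rightarrow> real"
  assumes problem: "msp_problem P"
    and diameter: "diameter_bound P D"
    and regular: "regularity P ebar"
    and F_lipschitz: "objective_lipschitz P M"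
    and \<delta>_nonneg: "\<forall>t\<in>{1..horizon P}. 0 \<le> \<delta> t"
    and run: "eddp_run P \<delta> R"
    and Flow_lipschitz: "lower_lipschitz P \<delta> R ebar Mlow"
begin

abbreviation "T \<equiv> horizon P"
abbreviation "\<epsilon> \<equiv> eps P M Mlow \<delta>"

lemma T_ge_2: "2 \<le> T"
  and disc_pos: "0 < disc P" and disc_le_1: "disc P \<le> 1"
  and scen_1: "scen P 1 = 1"
  and scen_pos: "t \<in> {1..T} \<Longrightarrow> 1 \<le> scen P t"
  using problem by (auto simp: msp_problem_def)

lemma performed_SucD:
  assumes "performed P \<delta> R (Suc (Suc k))"
  shows "performed P \<delta> R (Suc k)" "\<not> stops P \<delta> R (Suc k)"
  using assms by (auto simp: performed_def)

lemma forward: "performed P \<delta> R k \<Longrightarrow> forward_phase P R k"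
  using run by (simp add: eddp_run_def)

lemma backward: "performed P \<delta> R (Suc (Suc k)) \<Longrightarrow> backward_phase P \<delta> R (Suc k)"
  using run performed_SucD[of k] by (simp add: eddp_run_def)

lemma xtrial_feas:
  "performed P \<delta> R k \<Longrightarrow> t \<in> {1..T} \<Longrightarrow> i \<in> {1..scen P t} \<Longrightarrow>
    xtrial R k t i \<in> feas P t i (xsel R k (t - 1))"
  using forward by (auto simp: forward_phase_def is_arg_min_def)

lemma xtrial_minimizes:
  assumes "performed P \<delta> R k" "t \<in> {1..T}" "i \<in> {1..scen P t}"
  shows "Flow P R (k - 1) t i (xtrial R k t i) = \<nu>low P R (k - 1) t i (xsel R k (t - 1))"
  unfolding \<nu>low_def
proof (rule antisym)
  show "Flow P R (k - 1) t i (xtrial R k t i)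
      \<le> (INF z\<in>feas P t i (xsel R k (t - 1)). Flow P R (k - 1) t i z)"
    using forward[OF assms(1)] assms(2,3)
    by (intro INF_greatest) (auto simp: forward_phase_def is_arg_min_def not_less)
qed (rule INF_lower[OF xtrial_feas[OF assms]])

lemma xsel_is_xtrial:
  assumes "performed P \<delta> R k" "t \<in> {1..T}"
  obtains i where "i \<in> {1..scen P t}" "xsel R k t = xtrial R k t i"
proof -
  have "xsel R k t \<in> xtrial R k t ` {1..scen P t}"
    using forward[OF assms(1)] assms(2) unfolding forward_phase_def by blast
  then show thesis using that by blast
qed

lemma xtrial_sat_dist_le:
  assumes "performed P \<delta> R k" "t \<in> {1..T}" "i \<in> {1..scen P t}"
  shows "sat_dist P R k t (xtrial R k t i) \<le> sat_dist P R k t (xsel R k t)"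
proof -
  have "sat_dist P R k t (xsel R k t) = (MAX i\<in>{1..scen P t}. sat_dist P R k t (xtrial R k t i))"
    using forward[OF assms(1)] assms(2) by (auto simp: forward_phase_def)
  then show ?thesis using assms(3) by (auto intro: Max_ge)
qed

lemma trial_points_in_eff_region:
  assumes "performed P \<delta> R k" "t \<in> {1..T}"
  shows "xsel R k t \<in> eff_region P t"
    and "\<And>i. i \<in> {1..scen P t} \<Longrightarrow> xtrial R k t i \<in> eff_region P t"
proof -
  have "(\<forall>i\<in>{1..scen P t}. xtrial R k t i \<in> eff_region P t) \<and> xsel R k t \<in> eff_region P t"
    using assms(2)
  proof (induction t)
    case (Suc t)
    have trial: "xtrial R k (Suc t) i \<in> eff_region P (Suc t)" if i: "i \<in> {1..scen P (Suc t)}" for i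
    proof (cases "t = 0")
      case True
      then show ?thesis
        using xtrial_feas[OF assms(1) Suc.prems i] i scen_1 by (auto simp: feas_def Let_def)
    next
      case False
      then have "xsel R k t \<in> eff_region P t"
        using Suc by auto
      then show ?thesis
        using xtrial_feas[OF assms(1) Suc.prems i] i False by auto
    qed
    moreover obtain i where "i \<in> {1..scen P (Suc t)}" "xsel R k (Suc t) = xtrial R k (Suc t) i"
      by (rule xsel_is_xtrial[OF assms(1) Suc.prems])
    ultimately show ?case by metis
  qed simp
  then show "xsel R k t \<in> eff_region P t"
    and "\<And>i. i \<in> {1..scen P t} \<Longrightarrow> xtrial R k t i \<in> eff_region P t" by auto
qed

lemma eff_region_subset_coord_space:
  assumes "t \<in> {1..T}"
  shows "eff_region P t \<subseteq> coord_space (coords P t)"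
proof -
  have "eff_region P t \<subseteq> Xbar P t"
    using assms by (cases t) (auto simp: feas_def Let_def split: if_splits)
  moreover have "Xbar P t \<subseteq> coord_space (coords P t)"
    using problem assms unfolding msp_problem_def by blast
  ultimately show ?thesis by (rule order_trans)
qed

lemma eff_region_subset_enl:
  assumes "t \<in> {1..T}"
  shows "eff_region P t \<subseteq> eff_region_enl P t (ebar t)"
proof
  fix x assume x: "x \<in> eff_region P t"
  then have "x \<in> affine hull eff_region P t"
    by (rule hull_inc)
  then have "0 \<in> aff_dir (eff_region P t)"
    unfolding aff_dir_def by force
  moreover have "0 < ebar t"
    using regular assms by (simp add: regularity_def)
  ultimately show "x \<in> eff_region_enl P t (ebar t)"
    unfolding eff_region_enl_def using x by (force simp: infnorm_0)
qed

lemma Vlow_last: "Vlow R k (Suc T) x = 0" and V_last: "V P (Suc T) x = 0"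
  using run by (auto simp: eddp_run_def V.simps)

lemma Vlow_step:
  assumes "performed P \<delta> R (Suc (Suc k))" "t \<in> {2..T}"
  shows "Vlow R (Suc k) t x = max (Vlow R k t x) (cut P R (Suc k) t x)"
  using backward[OF assms(1)] assms(2) by (simp add: backward_phase_def)

lemma Vlow_mono:
  assumes "performed P \<delta> R (Suc (Suc k))" "t \<in> {2..Suc T}"
  shows "Vlow R k t x \<le> Vlow R (Suc k) t x"
proof (cases "t = Suc T")
  case False
  then show ?thesis using Vlow_step[OF assms(1), of t x] assms(2) by simp
qed (simp add: Vlow_last)

lemma discounted_sum_mono:
  "a \<le> b \<Longrightarrow> h + ereal (disc P) * a \<le> h + ereal (disc P) * b"
  using disc_pos by (intro add_left_mono ereal_mult_left_mono) auto

text \<open>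
  The cut of stage \<open>t\<close> is the average of affine functions which, by weak duality at every parameter,
  lie below the approximate value functions of the realizations.
\<close>

lemma cut_le_mean_\<nu>low:
  assumes "performed P \<delta> R (Suc (Suc k))" and t: "t \<in> {2..T}"
  shows "cut P R (Suc k) t x
    \<le> ereal (1 / real (scen P t)) * (\<Sum>j = 1..scen P t. \<nu>low P R (Suc k) t j x)"
proof -
  let ?x = "xsel R (Suc k) (t - 1)" and ?u = "multE R (Suc k) t" and ?v = "multI R (Suc k) t"
    and ?r = "1 / real (scen P t)" and ?g = "subgrad P R (Suc k) t"
  have affine: "\<nu>low P R (Suc k) t j ?x + ereal (?g j \<bullet> (x - ?x)) \<le> \<nu>low P R (Suc k) t j x"
    if j: "j \<in> {1..scen P t}" for j
  proof -
    have opt: "optimal_multipliers P t j (Flow P R (Suc k) t j) ?x (?u j) (?v j)"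
      using backward[OF assms(1)] t j by (simp add: backward_phase_def)
    then have "\<nu>low P R (Suc k) t j ?x = dual_fun P t j (Flow P R (Suc k) t j) ?x (?u j) (?v j)"
      and v: "\<forall>l. 0 \<le> ?v j $ l"
      by (auto simp: optimal_multipliers_def \<nu>low_def)
    then have "\<nu>low P R (Suc k) t j ?x + ereal (?g j \<bullet> (x - ?x))
        \<le> dual_fun P t j (Flow P R (Suc k) t j) x (?u j) (?v j)"
      unfolding subgrad_def by (simp only: dual_fun_affine_le)
    also have "\<dots> \<le> \<nu>low P R (Suc k) t j x"
      unfolding \<nu>low_def by (rule dual_fun_le_INF_feas[OF problem t j v])
    finally show ?thesis .
  qed
  have "cut P R (Suc k) t x
      = ereal ?r * (\<Sum>j = 1..scen P t. \<nu>low P R (Suc k) t j ?x + ereal (?g j \<bullet> (x - ?x)))"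
    by (subst ereal_scale_sum_add) (simp_all add: cut_def inner_sum_left)
  also have "\<dots> \<le> ereal ?r * (\<Sum>j = 1..scen P t. \<nu>low P R (Suc k) t j x)"
    by (intro ereal_mult_left_mono sum_mono affine) auto
  finally show ?thesis .
qed

lemma \<nu>low_le_\<nu>:
  assumes "\<And>z. Vlow R k (Suc t) z \<le> V P (Suc t) z"
  shows "\<nu>low P R k t i x \<le> \<nu> P t i x"
  unfolding \<nu>low_def \<nu>_def Flow_def F_def
  by (intro INF_mono) (use assms discounted_sum_mono in blast)

text \<open>
  The backward phase computes the cut of stage \<open>t\<close> from the model of stage \<open>t + 1\<close> already updated
  in the same iteration, hence a backward induction over the stages inside the one over iterations.
\<close>

lemma Vlow_le_V:
  assumes "performed P \<delta> R (Suc k)" "t \<in> {2..Suc T}"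
  shows "Vlow R k t x \<le> V P t x"
  using assms
proof (induction k arbitrary: t x)
  case 0
  then show ?case
    using run Vlow_last V_last by (cases "t = Suc T") (auto simp: eddp_run_def)
next
  case (Suc k)
  note perf = Suc.prems(1) and IH = Suc.IH[OF performed_SucD(1)[OF Suc.prems(1)]]
  have "t \<le> Suc T" using Suc.prems(2) by simp
  then have "2 \<le> t \<longrightarrow> (\<forall>x. Vlow R (Suc k) t x \<le> V P t x)"
  proof (induction t rule: inc_induct)
    case base
    then show ?case by (simp add: Vlow_last V_last)
  next
    case (step t)
    show ?case
    proof (intro impI allI)
      fix x assume "2 \<le> t"
      then have t: "t \<in> {2..T}" using step.hyps by simp
      have "cut P R (Suc k) t x
          \<le> ereal (1 / real (scen P t)) * (\<Sum>j = 1..scen P t. \<nu>low P R (Suc k) t j x)"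
        by (rule cut_le_mean_\<nu>low[OF perf t])
      also have "\<dots> \<le> ereal (1 / real (scen P t)) * (\<Sum>j = 1..scen P t. \<nu> P t j x)"
        using step.IH t by (intro ereal_mult_left_mono sum_mono \<nu>low_le_\<nu>) auto
      also have "\<dots> = V P t x"
        using t by (simp add: V_eq_mean_\<nu>)
      finally show "Vlow R (Suc k) t x \<le> V P t x"
        using Vlow_step[OF perf t] IH[of t x] t by simp
    qed
  qed
  then show ?case using Suc.prems(2) by simp
qed

section \<open>Saturated points\<close>

text \<open>
  This turns the syntactic membership in \<open>Ssat\<close> into the property that it is meant to certify;
  finiteness makes the distance to the saturated points an attained one.
\<close>

definition saturated :: "nat \<Rightarrow> nat \<Rightarrow> bool" where
  "saturated k t \<longleftrightarrow> finite (Ssat R k t) \<and>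
     (\<forall>s\<in>Ssat R k t. s \<in> eff_region P t \<and> V P (Suc t) s \<le> Vlow R k (Suc t) s + ereal (\<epsilon> t))"

text \<open>
  A trial point within \<open>\<delta> t\<close> of a saturated point \<open>s\<close> inherits the accuracy of the model at \<open>s\<close>
  up to the Lipschitz constants of the true and of the approximate objective; this is the recursion
  that defines the tolerances.  In the last stage the model is exact.
\<close>

lemma trial_point_gap:
  assumes perf: "performed P \<delta> R (Suc k)" and t: "t \<in> {1..T}" and i: "i \<in> {1..scen P t}"
    and sat: "t < T \<Longrightarrow> saturated k t"
    and close: "sat_dist P R (Suc k) t (xsel R (Suc k) t) \<le> ereal (\<delta> t)"
  shows "F P t i (xtrial R (Suc k) t i)
    \<le> Flow P R k t i (xtrial R (Suc k) t i) + ereal (\<epsilon> (t - 1))"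
proof (cases "t = T")
  case True
  then show ?thesis by (simp add: F_def Flow_def Vlow_last V_last eps_def)
next
  case False
  then have "t < T" using t by simp
  let ?x = "xtrial R (Suc k) t i"
  have le: "(INF s\<in>Ssat R k t. ereal (infnorm (s - ?x))) \<le> ereal (\<delta> t)"
    using xtrial_sat_dist_le[OF perf t i] close \<open>t < T\<close> by (simp add: sat_dist_def)
  then have ne: "Ssat R k t \<noteq> {}"
    by (auto simp: top_ereal_def)
  have "finite (Ssat R k t)"
    using sat[OF \<open>t < T\<close>] by (simp add: saturated_def)
  then obtain s where s: "s \<in> Ssat R k t"
    and "(INF s\<in>Ssat R k t. ereal (infnorm (s - ?x))) = ereal (infnorm (s - ?x))"
    using ne by (rule INF_finite_attained)
  with le have dist: "infnorm (s - ?x) \<le> \<delta> t" by simp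
  have s_eff: "s \<in> eff_region P t" and s_sat: "V P (Suc t) s \<le> Vlow R k (Suc t) s + ereal (\<epsilon> t)"
    using sat[OF \<open>t < T\<close>] s by (auto simp: saturated_def)
  have x_eff: "?x \<in> eff_region P t"
    using trial_points_in_eff_region(2)[OF perf t i] .
  \<comment> \<open>Initially there are no saturated points, so the lower model comes from an earlier iteration.\<close>
  have "k \<noteq> 0"
  proof
    assume "k = 0"
    moreover have "\<forall>t\<in>{1..<T}. Ssat R 0 t = {}"
      using run unfolding eddp_run_def by blast
    ultimately have "Ssat R k t = {}"
      using t \<open>t < T\<close> by simp
    with s show False by simp
  qed
  then obtain k' where k': "k = Suc k'" by (cases k) auto
  have "ereal_lipschitz_on (Mlow t) (eff_region_enl P t (ebar t)) (Flow P R k t i)"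
    and Mlow: "0 \<le> Mlow t"
    using Flow_lipschitz performed_SucD[of k'] perf t i k' by (auto simp: lower_lipschitz_def)
  then have "\<bar>Flow P R k t i s - Flow P R k t i ?x\<bar> \<le> ereal (Mlow t * infnorm (s - ?x))"
    using s_eff x_eff eff_region_subset_enl[OF t] by (auto simp: ereal_lipschitz_on_def)
  also have "\<dots> \<le> ereal (Mlow t * \<delta> t)"
    using dist Mlow by (simp add: mult_left_mono)
  finally have Flow_le: "Flow P R k t i s \<le> Flow P R k t i ?x + ereal (Mlow t * \<delta> t)"
    by (rule ereal_abs_diff_leD)
  have M: "0 \<le> M t"
    using F_lipschitz t by (auto simp: objective_lipschitz_def)
  have "\<bar>F P t i ?x - F P t i s\<bar> \<le> ereal (M t * infnorm (?x - s))"
    using F_lipschitz t i s_eff x_eff by (auto simp: objective_lipschitz_def ereal_lipschitz_on_def)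
  also have "ereal (M t * infnorm (?x - s)) \<le> ereal (M t * \<delta> t)"
    using dist M by (simp add: mult_left_mono infnorm_sub)
  finally have F_le: "F P t i ?x \<le> F P t i s + ereal (M t * \<delta> t)"
    by (rule ereal_abs_diff_leD)
  have "F P t i s \<le> H P t s (parc (xi P t i))
      + ereal (disc P) * (Vlow R k (Suc t) s + ereal (\<epsilon> t))"
    unfolding F_def by (rule discounted_sum_mono[OF s_sat])
  also have "\<dots> = Flow P R k t i s + ereal (disc P * \<epsilon> t)"
    using disc_pos by (simp add: Flow_def ereal_pos_distrib add.assoc)
  finally have "F P t i s \<le> Flow P R k t i s + ereal (disc P * \<epsilon> t)" .
  then have "F P t i ?x \<le> Flow P R k t i ?x + ereal (Mlow t * \<delta> t)
      + ereal (disc P * \<epsilon> t) + ereal (M t * \<delta> t)"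
    using F_le Flow_le by (meson add_right_mono order_trans)
  also have "\<dots> = Flow P R k t i ?x + ereal (Mlow t * \<delta> t + disc P * \<epsilon> t + M t * \<delta> t)"
    by (simp add: add.assoc)
  also have "Mlow t * \<delta> t + disc P * \<epsilon> t + M t * \<delta> t = \<epsilon> (t - 1)"
    using eps_rec[of "t - 1" P M Mlow \<delta>] \<open>t < T\<close> t by (simp add: algebra_simps)
  finally show ?thesis .
qed

text \<open>
  The cut of stage \<open>t\<close> is tight at the point where it is taken, so a small gap at all trial points
  of stage \<open>t\<close> becomes accuracy of the model at their predecessor.
\<close>

lemma predecessor_becomes_saturated:
  assumes perf: "performed P \<delta> R (Suc (Suc k))" and t: "t \<in> {2..T}"
    and sat: "t < T \<Longrightarrow> saturated k t"
    and close: "sat_dist P R (Suc k) t (xsel R (Suc k) t) \<le> ereal (\<delta> t)"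
  shows "V P t (xsel R (Suc k) (t - 1))
    \<le> Vlow R (Suc k) t (xsel R (Suc k) (t - 1)) + ereal (\<epsilon> (t - 1))"
proof -
  let ?x = "xsel R (Suc k) (t - 1)" and ?r = "1 / real (scen P t)"
  have t': "t \<in> {1..T}" using t by simp
  have gap: "\<nu> P t i ?x \<le> \<nu>low P R (Suc k) t i ?x + ereal (\<epsilon> (t - 1))"
    if i: "i \<in> {1..scen P t}" for i
  proof -
    note perf' = performed_SucD(1)[OF perf]
    have "\<nu> P t i ?x \<le> F P t i (xtrial R (Suc k) t i)"
      unfolding \<nu>_def by (rule INF_lower[OF xtrial_feas[OF perf' t' i]])
    also have "\<dots> \<le> Flow P R k t i (xtrial R (Suc k) t i) + ereal (\<epsilon> (t - 1))"
      by (rule trial_point_gap[OF perf' t' i sat close])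
    also have "Flow P R k t i (xtrial R (Suc k) t i) = \<nu>low P R k t i ?x"
      using xtrial_minimizes[OF perf' t' i] by simp
    also have "\<nu>low P R k t i ?x \<le> \<nu>low P R (Suc k) t i ?x"
    proof -
      have "Vlow R k (Suc t) z \<le> Vlow R (Suc k) (Suc t) z" for z
        using t by (intro Vlow_mono[OF perf]) simp
      then show ?thesis
        unfolding \<nu>low_def Flow_def by (intro INF_mono) (use discounted_sum_mono in blast)
    qed
    finally show ?thesis by (simp add: add_right_mono)
  qed
  have "V P t ?x = ereal ?r * (\<Sum>i = 1..scen P t. \<nu> P t i ?x)"
    using t by (simp add: V_eq_mean_\<nu>)
  also have "\<dots> \<le> ereal ?r * (\<Sum>i = 1..scen P t. \<nu>low P R (Suc k) t i ?x + ereal (\<epsilon> (t - 1)))"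
    by (intro ereal_mult_left_mono sum_mono gap) auto
  also have "\<dots> = ereal ?r * (\<Sum>i = 1..scen P t. \<nu>low P R (Suc k) t i ?x)
      + ereal (?r * (\<Sum>i = 1..scen P t. \<epsilon> (t - 1)))"
    by (rule ereal_scale_sum_add) simp
  also have "?r * (\<Sum>i = 1..scen P t. \<epsilon> (t - 1)) = \<epsilon> (t - 1)"
    using scen_pos[OF t'] by simp
  also have "ereal ?r * (\<Sum>i = 1..scen P t. \<nu>low P R (Suc k) t i ?x) = cut P R (Suc k) t ?x"
    by (simp add: cut_def)
  also have "cut P R (Suc k) t ?x \<le> Vlow R (Suc k) t ?x"
    using Vlow_step[OF perf t] by simp
  finally show ?thesis by (simp add: add_right_mono)
qed

lemma Ssat_step:
  assumes "performed P \<delta> R (Suc (Suc k))" "t \<in> {1..<T}"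
  shows "Ssat R (Suc k) t =
    (if sat_dist P R (Suc k) (Suc t) (xsel R (Suc k) (Suc t)) \<le> ereal (\<delta> (Suc t))
     then insert (xsel R (Suc k) t) (Ssat R k t) else Ssat R k t)"
proof -
  have "Suc t \<in> {2..T}" using assms(2) by simp
  from backward[OF assms(1), unfolded backward_phase_def, THEN bspec, OF this, THEN conjunct1]
  show ?thesis by simp
qed

text \<open>
  Old saturated points stay accurate because the lower models increase; new ones are accurate by
  \<open>predecessor_becomes_saturated\<close>, applied to the saturated points of the preceding iteration.
\<close>

lemma saturated_points:
  assumes "performed P \<delta> R (Suc k)" "t \<in> {1..<T}"
  shows "saturated k t"
  using assms
proof (induction k arbitrary: t)
  case 0
  have "\<forall>t\<in>{1..<T}. Ssat R 0 t = {}"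
    using run unfolding eddp_run_def by blast
  with 0 show ?case by (simp add: saturated_def)
next
  case (Suc k)
  note perf = Suc.prems(1)
  note perf' = performed_SucD(1)[OF perf]
  note IH = Suc.IH[OF perf']
  have t: "t \<in> {1..T}" and St: "Suc t \<in> {2..T}"
    using Suc.prems(2) by auto
  have old: "V P (Suc t) s \<le> Vlow R (Suc k) (Suc t) s + ereal (\<epsilon> t)" if "s \<in> Ssat R k t" for s
  proof -
    have "V P (Suc t) s \<le> Vlow R k (Suc t) s + ereal (\<epsilon> t)"
      using IH[OF Suc.prems(2)] that by (simp add: saturated_def)
    also have "\<dots> \<le> Vlow R (Suc k) (Suc t) s + ereal (\<epsilon> t)"
      using St by (intro add_right_mono Vlow_mono[OF perf]) auto
    finally show ?thesis .
  qed
  have new: "V P (Suc t) (xsel R (Suc k) t) \<le> Vlow R (Suc k) (Suc t) (xsel R (Suc k) t) + ereal (\<epsilon> t)"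
    if "sat_dist P R (Suc k) (Suc t) (xsel R (Suc k) (Suc t)) \<le> ereal (\<delta> (Suc t))"
    using predecessor_becomes_saturated[OF perf St _ that] IH St by simp
  show ?case
    using IH[OF Suc.prems(2)] old new trial_points_in_eff_region(1)[OF perf' t]
    unfolding saturated_def Ssat_step[OF perf Suc.prems(2)] by auto
qed

section \<open>Quality of the solution\<close>

text \<open>
  The point found minimizes a function below the true objective, so its model value is a lower bound
  of \<open>Fstar P\<close>, and the stopping rule controls the gap between model and truth at this point.
\<close>

lemma gap_at_termination:
  assumes "terminates_at P \<delta> R k"
  shows "F P 1 1 (xsel R k 1) - Fstar P \<le> ereal (\<epsilon> 0)"
proof -
  have perf: "performed P \<delta> R k" and stop: "stops P \<delta> R k"
    using assms by (auto simp: terminates_at_def)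
  then obtain l where k: "k = Suc l" by (cases k) (auto simp: performed_def)
  have t: "1 \<in> {1..T}" "1 \<in> {1..<T}" using T_ge_2 by auto
  have i: "1 \<in> {1..scen P 1}" using scen_1 by simp
  obtain j where "j \<in> {1..scen P 1}" and "xsel R k 1 = xtrial R k 1 j"
    by (rule xsel_is_xtrial[OF perf t(1)])
  then have sel: "xsel R k 1 = xtrial R k 1 1"
    unfolding scen_1 by auto
  have close: "sat_dist P R (Suc l) 1 (xsel R (Suc l) 1) \<le> ereal (\<delta> 1)"
    using stop by (simp add: stops_def k)
  have "F P 1 1 (xtrial R k 1 1) \<le> Flow P R l 1 1 (xtrial R k 1 1) + ereal (\<epsilon> 0)"
    using trial_point_gap[OF perf[unfolded k] t(1) i saturated_points[OF perf[unfolded k] t(2)] close]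
    by (simp add: k)
  also have "Flow P R l 1 1 (xtrial R k 1 1) = \<nu>low P R l 1 1 (xsel R k 0)"
    using xtrial_minimizes[OF perf t(1) i] k by simp
  also have "\<dots> \<le> \<nu> P 1 1 (xsel R k 0)"
    using T_ge_2 by (intro \<nu>low_le_\<nu> Vlow_le_V[OF perf[unfolded k]]) auto
  also have "\<dots> = Fstar P"
    by (simp add: \<nu>_def Fstar_def feas_def)
  finally have le: "F P 1 1 (xsel R k 1) \<le> Fstar P + ereal (\<epsilon> 0)"
    unfolding sel by (simp add: add_right_mono)
  have x: "xsel R k 1 \<in> eff_region P 1"
    by (rule trial_points_in_eff_region(1)[OF perf t(1)])
  then have "Fstar P \<le> F P 1 1 (xsel R k 1)"
    unfolding Fstar_def by (intro INF_lower) simp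
  \<comment> \<open>The Lipschitz bound at two equal points expresses finiteness, so the difference can be formed.\<close>
  moreover have "\<bar>F P 1 1 (xsel R k 1) - F P 1 1 (xsel R k 1)\<bar>
      \<le> ereal (M 1 * infnorm (xsel R k 1 - xsel R k 1))"
    using F_lipschitz t i x unfolding objective_lipschitz_def ereal_lipschitz_on_def by blast
  then have "\<bar>F P 1 1 (xsel R k 1)\<bar> \<noteq> \<infinity>"
    by auto
  ultimately have "\<bar>Fstar P\<bar> \<noteq> \<infinity>"
    using le by (cases "Fstar P"; cases "F P 1 1 (xsel R k 1)") auto
  with le show ?thesis
    by (simp add: ereal_minus_le add.commute)
qed

section \<open>Counting iterations\<close>

definition new_saturated :: "nat \<Rightarrow> nat \<Rightarrow> bool" where
  "new_saturated t k \<longleftrightarrow>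
     ereal (\<delta> t) < sat_dist P R k t (xsel R k t) \<and> xsel R k t \<in> Ssat R k t"

text \<open>
  The first stage is far from its saturated points, as the iteration does not stop, and the last
  one is close by convention.  So there is a last far stage \<open>t < T\<close>, and since stage \<open>t + 1\<close> is
  close, the backward phase declares the point of stage \<open>t\<close> saturated.
\<close>

lemma ex_new_saturated:
  assumes "performed P \<delta> R (Suc (Suc k))"
  shows "\<exists>t\<in>{1..<T}. new_saturated t (Suc k)"
proof -
  define far where "far t \<longleftrightarrow> ereal (\<delta> t) < sat_dist P R (Suc k) t (xsel R (Suc k) t)" for t
  define t where "t = Max {t\<in>{1..<T}. far t}"
  have "1 \<in> {t\<in>{1..<T}. far t}"
    using performed_SucD(2)[OF assms] T_ge_2 by (auto simp: stops_def far_def)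
  then have "t \<in> {t\<in>{1..<T}. far t}"
    unfolding t_def by (intro Max_in) auto
  then have t: "t \<in> {1..<T}" "far t" by auto
  have "\<not> far (Suc t)"
  proof (cases "Suc t = T")
    case True
    then show ?thesis using \<delta>_nonneg T_ge_2 by (auto simp: far_def sat_dist_def not_less)
  next
    case False
    show ?thesis
    proof
      assume "far (Suc t)"
      then have "Suc t \<le> t"
        using False t unfolding t_def by (intro Max_ge) auto
      then show False by simp
    qed
  qed
  then have "xsel R (Suc k) t \<in> Ssat R (Suc k) t"
    using Ssat_step[OF assms t(1)] by (simp add: far_def not_less)
  with t show ?thesis
    by (auto simp: new_saturated_def far_def)
qed

lemma Ssat_mono:
  assumes "performed P \<delta> R (Suc l)" "t \<in> {1..<T}" "k \<le> l"
  shows "Ssat R k t \<subseteq> Ssat R l t"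
  using assms(3,1)
proof (induction l rule: dec_induct)
  case (step l)
  then show ?case
    using Ssat_step[OF step.prems assms(2)] performed_SucD(1)[OF step.prems] by auto
qed simp

text \<open>
  Saturated points are never removed, so a point entering later was far from all those that entered
  earlier: the entering points are separated.
\<close>

lemma card_new_saturated_le:
  assumes perf: "performed P \<delta> R (Suc m)" and t: "t \<in> {1..<T}" and "0 < \<delta> t"
  shows "real (card {k\<in>{1..m}. new_saturated t k}) \<le> (D t / \<delta> t + 1) ^ stage_dim P t"
proof -
  let ?K = "{k\<in>{1..m}. new_saturated t k}" and ?x = "\<lambda>k. xsel R k t"
  have perf_le: "performed P \<delta> R (Suc k)" if "k \<le> m" for k
    using perf that by (auto simp: performed_def)
  have t': "t \<in> {1..T}" using t by auto
  have sep: "\<delta> t < infnorm (?x j - ?x k)" if "j \<in> ?K" "k \<in> ?K" "j < k" for j k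
  proof -
    have "performed P \<delta> R (Suc (k - 1))" "j \<le> k - 1"
      using perf_le[of "k - 1"] that by auto
    from Ssat_mono[OF this(1) t this(2)] have "?x j \<in> Ssat R (k - 1) t"
      using that(1) by (auto simp: new_saturated_def)
    then have "sat_dist P R k t (?x k) \<le> ereal (infnorm (?x j - ?x k))"
      using t by (auto simp: sat_dist_def intro: INF_lower)
    with that(2) show ?thesis
      by (auto simp: new_saturated_def dest: less_le_trans)
  qed
  have sep': "\<delta> t < infnorm (?x j - ?x k)" if "j \<in> ?K" "k \<in> ?K" "j \<noteq> k" for j k
    using sep[of j k] sep[of k j] that by (metis infnorm_sub nat_neq_iff)
  have inj: "inj_on ?x ?K"
    using sep' \<open>0 < \<delta> t\<close> by (intro inj_onI) (fastforce simp: infnorm_0)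
  have eff: "?x ` ?K \<subseteq> eff_region P t"
  proof
    fix x assume "x \<in> ?x ` ?K"
    then obtain k where k: "k \<in> {1..m}" "x = ?x k" by blast
    then have "performed P \<delta> R k"
      using perf by (auto simp: performed_def)
    with k show "x \<in> eff_region P t"
      using trial_points_in_eff_region(1) t' by blast
  qed
  have "card ?K = card (?x ` ?K)"
    by (rule card_image[OF inj, symmetric])
  also have "real (card (?x ` ?K)) \<le> (D t / \<delta> t + 1) ^ card (coords P t)"
  proof (rule card_infnorm_separated_le(2)[OF _ \<open>0 < \<delta> t\<close>])
    show "?x ` ?K \<subseteq> coord_space (coords P t)"
      using eff eff_region_subset_coord_space[OF t'] by blast
    show "0 \<le> D t"
      using diameter t' by (simp add: diameter_bound_def)
    show "infnorm (x - y) \<le> D t" if "x \<in> ?x ` ?K" "y \<in> ?x ` ?K" for x y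
      using diameter t' eff that unfolding diameter_bound_def by blast
    show "\<delta> t < infnorm (x - y)" if "x \<in> ?x ` ?K" "y \<in> ?x ` ?K" "x \<noteq> y" for x y
      using sep' that by blast
  qed
  finally show ?thesis by (simp add: stage_dim_def)
qed

lemma performed_le:
  assumes perf: "performed P \<delta> R (Suc m)" and "\<And>t. t \<in> {1..<T} \<Longrightarrow> 0 < \<delta> t"
  shows "real m \<le> (\<Sum>t\<in>{1..<T}. (D t / \<delta> t + 1) ^ stage_dim P t)"
proof -
  have "{1..m} \<subseteq> (\<Union>t\<in>{1..<T}. {k\<in>{1..m}. new_saturated t k})"
  proof
    fix k assume k: "k \<in> {1..m}"
    then obtain l where l: "k = Suc l" by (cases k) auto
    then have "performed P \<delta> R (Suc (Suc l))"
      using perf k by (auto simp: performed_def)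
    from ex_new_saturated[OF this] show "k \<in> (\<Union>t\<in>{1..<T}. {k\<in>{1..m}. new_saturated t k})"
      using k l by auto
  qed
  then have "card {1..m} \<le> card (\<Union>t\<in>{1..<T}. {k\<in>{1..m}. new_saturated t k})"
    by (intro card_mono) auto
  also have "\<dots> \<le> (\<Sum>t\<in>{1..<T}. card {k\<in>{1..m}. new_saturated t k})"
    by (rule card_UN_le) simp
  finally have "real m \<le> (\<Sum>t\<in>{1..<T}. real (card {k\<in>{1..m}. new_saturated t k}))"
    by (simp flip: of_nat_sum)
  also have "\<dots> \<le> (\<Sum>t\<in>{1..<T}. (D t / \<delta> t + 1) ^ stage_dim P t)"
    using assms by (intro sum_mono card_new_saturated_le) auto
  finally show ?thesis .
qed

lemma ex_terminates_at:
  assumes "\<And>t. t \<in> {1..<T} \<Longrightarrow> 0 < \<delta> t"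
  obtains k where "terminates_at P \<delta> R k"
    "real k \<le> (\<Sum>t\<in>{1..<T}. (D t / \<delta> t + 1) ^ stage_dim P t) + 1"
proof -
  let ?K = "\<Sum>t\<in>{1..<T}. (D t / \<delta> t + 1) ^ stage_dim P t"
  have "\<exists>k. 1 \<le> k \<and> stops P \<delta> R k"
  proof (rule ccontr)
    assume "\<not> ?thesis"
    then have "performed P \<delta> R (Suc m)" for m
      by (auto simp: performed_def)
    from performed_le[OF this assms] have "real m \<le> ?K" for m .
    then show False
      by (metis reals_Archimedean2 not_le)
  qed
  define k where "k = (LEAST k. 1 \<le> k \<and> stops P \<delta> R k)"
  from \<open>\<exists>k. _\<close> have k: "1 \<le> k \<and> stops P \<delta> R k"
    unfolding k_def by (rule LeastI_ex)
  have "performed P \<delta> R k"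
    using k by (auto simp: performed_def k_def dest: not_less_Least)
  moreover have "real (k - 1) \<le> ?K"
    using performed_le[of "k - 1"] assms calculation k by simp
  ultimately show thesis
    using that[of k] k by (auto simp: terminates_at_def)
qed

section \<open>The complexity bounds\<close>

lemma num_iterations_le: "ereal_of_enat (num_iterations P \<delta> R) \<le> Kbar P D \<delta> + 1"
proof (cases "\<exists>t\<in>{1..T - 1}. \<delta> t = 0")
  case True
  then show ?thesis by (simp add: Kbar_def)
next
  case False
  have stages: "{1..<T} = {1..T - 1}"
    using T_ge_2 by auto
  have "0 < \<delta> t" if "t \<in> {1..<T}" for t
    using False \<delta>_nonneg that by (force simp: stages less_le)
  from ex_terminates_at[OF this] obtain k where k: "terminates_at P \<delta> R k"
    "real k \<le> (\<Sum>t\<in>{1..<T}. (D t / \<delta> t + 1) ^ stage_dim P t) + 1"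
    by blast
  have "num_iterations P \<delta> R \<le> enat k"
    unfolding num_iterations_def using k(1) by (intro INF_lower) simp
  then have "ereal_of_enat (num_iterations P \<delta> R) \<le> ereal_of_enat (enat k)"
    by (simp only: ereal_of_enat_le_iff)
  also have "\<dots> = ereal (real k)"
    by simp
  also have "\<dots> \<le> Kbar P D \<delta> + 1"
    using k(2) False unfolding Kbar_def stages by (simp add: one_ereal_def)
  finally show ?thesis .
qed

lemma eps_0_le:
  assumes "\<And>t. t \<in> {1..<T} \<Longrightarrow> M t \<le> Mmax \<and> Mlow t \<le> Mmax \<and> \<delta> t = e" and "0 < e"
  shows "\<epsilon> 0 \<le> 2 * Mmax *
    (if disc P = 1 then real (T - 1) else min (1 / (1 - disc P)) (real (T - 1))) * e"
proof -
  have Mmax: "0 \<le> Mmax"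
  proof -
    have "0 \<le> M 1"
      using F_lipschitz T_ge_2 by (simp add: objective_lipschitz_def)
    also have "M 1 \<le> Mmax"
      using assms(1)[of 1] T_ge_2 by simp
    finally show ?thesis .
  qed
  have "\<epsilon> 0 = (\<Sum>\<tau>\<in>{..<T - 1}. (M (\<tau> + 1) + Mlow (\<tau> + 1)) * \<delta> (\<tau> + 1) * disc P ^ \<tau>)"
  proof -
    have "{0..T - 2} = {..<T - 1}" using T_ge_2 by auto
    then show ?thesis using T_ge_2 by (simp add: eps_def)
  qed
  also have "\<dots> \<le> (\<Sum>\<tau>\<in>{..<T - 1}. 2 * Mmax * e * disc P ^ \<tau>)"
  proof (rule sum_mono)
    fix \<tau> assume "\<tau> \<in> {..<T - 1}"
    then have b: "M (\<tau> + 1) \<le> Mmax" "Mlow (\<tau> + 1) \<le> Mmax" "\<delta> (\<tau> + 1) = e"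
      using assms(1)[of "\<tau> + 1"] by auto
    then have "(M (\<tau> + 1) + Mlow (\<tau> + 1)) * e * disc P ^ \<tau> \<le> 2 * Mmax * e * disc P ^ \<tau>"
      using \<open>0 < e\<close> disc_pos by (intro mult_right_mono) auto
    then show "(M (\<tau> + 1) + Mlow (\<tau> + 1)) * \<delta> (\<tau> + 1) * disc P ^ \<tau> \<le> 2 * Mmax * e * disc P ^ \<tau>"
      using b by simp
  qed
  also have "\<dots> = 2 * Mmax * (\<Sum>\<tau><T - 1. disc P ^ \<tau>) * e"
    by (simp add: sum_distrib_left mult_ac)
  also have "\<dots> \<le> 2 * Mmax *
    (if disc P = 1 then real (T - 1) else min (1 / (1 - disc P)) (real (T - 1))) * e"
  proof (intro mult_right_mono mult_left_mono)
    have "(\<Sum>\<tau><T - 1. disc P ^ \<tau>) \<le> (\<Sum>\<tau><T - 1. 1)"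
      using disc_pos disc_le_1 by (intro sum_mono power_le_one) auto
    moreover have "(\<Sum>\<tau><T - 1. disc P ^ \<tau>) \<le> 1 / (1 - disc P)" if "disc P \<noteq> 1"
      using that disc_pos disc_le_1 by (simp add: sum_gp_strict divide_right_mono)
    ultimately show "(\<Sum>\<tau><T - 1. disc P ^ \<tau>)
      \<le> (if disc P = 1 then real (T - 1) else min (1 / (1 - disc P)) (real (T - 1)))"
      by auto
  qed (use Mmax \<open>0 < e\<close> in auto)
  finally show ?thesis .
qed

lemma ex_uniform_iteration_bound:
  assumes "\<And>t. t \<in> {1..<T} \<Longrightarrow> stage_dim P t \<le> n \<and> D t \<le> Dmax \<and> \<delta> t = e" and "0 < e"
  obtains k where "terminates_at P \<delta> R k" "real k \<le> real (T - 1) * (Dmax / e + 1) ^ n + 1"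
proof -
  obtain k where k: "terminates_at P \<delta> R k"
    "real k \<le> (\<Sum>t\<in>{1..<T}. (D t / \<delta> t + 1) ^ stage_dim P t) + 1"
    using ex_terminates_at assms by metis
  have "(\<Sum>t\<in>{1..<T}. (D t / \<delta> t + 1) ^ stage_dim P t) \<le> (\<Sum>t\<in>{1..<T}. (Dmax / e + 1) ^ n)"
  proof (rule sum_mono)
    fix t assume t: "t \<in> {1..<T}"
    then have D: "0 \<le> D t"
      using diameter by (simp add: diameter_bound_def)
    have "(D t / e + 1) ^ stage_dim P t \<le> (Dmax / e + 1) ^ stage_dim P t"
      using assms(1)[OF t] D \<open>0 < e\<close> by (intro power_mono add_right_mono divide_right_mono) auto
    also have "\<dots> \<le> (Dmax / e + 1) ^ n"
      using assms(1)[OF t] D \<open>0 < e\<close> by (intro power_increasing) auto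
    finally show "(D t / \<delta> t + 1) ^ stage_dim P t \<le> (Dmax / e + 1) ^ n"
      using assms(1)[OF t] by simp
  qed
  also have "\<dots> = real (T - 1) * (Dmax / e + 1) ^ n"
    by simp
  finally show thesis using k that by force
qed

end

theorem theorem2:
  fixes P :: "('n::finite, 'm::finite, 'q::finite, 'p, 'c) msp"
    and R :: "('n, 'm, 'q) eddp_exec"
    and D M Mlow ebar \<delta> :: "nat \<Rightarrow> real"
  assumes "msp_problem P"
    and "diameter_bound P D"
    and "regularity P ebar"
    and "objective_lipschitz P M"
    and "\<forall>t\<in>{1..horizon P}. 0 \<le> \<delta> t"
    and "eddp_run P \<delta> R"
    and "lower_lipschitz P \<delta> R ebar Mlow"
  shows "(ereal_of_enat (num_iterations P \<delta> R) \<le> Kbar P D \<delta> + 1 \<and>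
          (\<forall>k. terminates_at P \<delta> R k \<longrightarrow>
             F P 1 1 (xsel R k 1) - Fstar P \<le> ereal (eps P M Mlow \<delta> 0)))
       \<and> (\<forall>(n :: nat) (Dmax :: real) (Mmax :: real) (\<epsilon> :: real).
            0 < \<epsilon> \<and>
            (\<forall>t\<in>{1..horizon P}. stage_dim P t \<le> n \<and> D t \<le> Dmax \<and>
                max (M t) (Mlow t) \<le> Mmax \<and> \<delta> t = \<epsilon>) \<longrightarrow>
            (\<exists>k. terminates_at P \<delta> R k \<and>
                 real k \<le> real (horizon P - 1) * (Dmax / \<epsilon> + 1) ^ n + 1 \<and>
                 F P 1 1 (xsel R k 1) - Fstar P \<le>
                   ereal (2 * Mmax *
                     (if disc P = 1 then real (horizon P - 1)
                      else min (1 / (1 - disc P)) (real (horizon P - 1))) * \<epsilon>)))"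
proof -
  interpret eddp_execution P R D M Mlow ebar \<delta>
    by (unfold_locales) (fact assms)+
  show ?thesis
  proof (intro conjI allI impI)
    show "ereal_of_enat (num_iterations P \<delta> R) \<le> Kbar P D \<delta> + 1"
      by (rule num_iterations_le)
    show "F P 1 1 (xsel R k 1) - Fstar P \<le> ereal (eps P M Mlow \<delta> 0)"
      if "terminates_at P \<delta> R k" for k
      by (rule gap_at_termination[OF that])
  next
    fix n :: nat and Dmax Mmax e :: real
    assume unif: "0 < e \<and> (\<forall>t\<in>{1..horizon P}. stage_dim P t \<le> n \<and> D t \<le> Dmax \<and>
                max (M t) (Mlow t) \<le> Mmax \<and> \<delta> t = e)"
    then obtain k where k: "terminates_at P \<delta> R k"
      "real k \<le> real (horizon P - 1) * (Dmax / e + 1) ^ n + 1"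
      using ex_uniform_iteration_bound[of n Dmax e] by auto
    have "F P 1 1 (xsel R k 1) - Fstar P \<le> ereal (eps P M Mlow \<delta> 0)"
      by (rule gap_at_termination[OF k(1)])
    also have "\<dots> \<le> ereal (2 * Mmax *
        (if disc P = 1 then real (horizon P - 1)
         else min (1 / (1 - disc P)) (real (horizon P - 1))) * e)"
      using eps_0_le[of Mmax e] unif by simp
    finally show "\<exists>k. terminates_at P \<delta> R k \<and>
        real k \<le> real (horizon P - 1) * (Dmax / e + 1) ^ n + 1 \<and>
        F P 1 1 (xsel R k 1) - Fstar P \<le> ereal (2 * Mmax *
          (if disc P = 1 then real (horizon P - 1)
           else min (1 / (1 - disc P)) (real (horizon P - 1))) * e)"
      using k by blast
  qed
qed

end
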